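(* Let $G_1$ and $G_2$ be broken sun graphs of orders $n_1$ and $n_2$ and girths $g_1$ and $g_2$, respectively, neither of which has a perfect matching. Suppose that $g_1\equiv g_2\equiv 0\pmod 4$ and that, in each of $G_1$ and $G_2$, there is an odd number of vertices of degree $2$ between any pair of consecutive vertices of degree $3$ (consecutive along the cycle). Then, for any one-edge connection $G=G_1\odot G_2$, the Laplacian matrix $L(G)$ has eigenvalue $2$.
   Context: All graphs are finite, undirected, with no loops or multiple edges. The Laplacian matrix of $G$ is $L(G)=D(G)-A(G)$, where $D(G)$ is the diagonal matrix of vertex degrees and $A(G)$ is the adjacency matrix. A unicyclic graph is a connected graph whose number of edges equals its number of vertices. The sun graph of order $2m$ ($m\ge 3$) is the cycle $C_m$ with one pendant vertex attached to each vertex of the cycle. A broken sun graph is a unicyclic subgraph of a sun graph; its girth is the length of its unique cycle, and its cycle vertices have degree $2$ or $3$. In the hypothesis, degrees are taken in $G_1$ (respectively $G_2$), not in $G$. A one-edge connection $G_1\odot G_2$ of two (vertex-disjoint) graphs $G_1,G_2$ is any graph $G$ with $V(G)=V(G_1)\cup V(G_2)$ and $E(G)=E(G_1)\cup E(G_2)\cup\{uv\}$ for some $u\in V(G_1)$ and $v\in V(G_2)$. *)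

theory Defs
  imports
    "Graph_Theory.Pair_Digraph"
    "Graph_Theory.Digraph_Isomorphism"
    "Jordan_Normal_Form.Char_Poly"
begin

text \<open>
  A finite simple graph is a \<^locale>\<open>pair_graph\<close>: a finite loopfree digraph with arcs in
  \<open>V \<times> V\<close> and a symmetric arc set, each undirected edge \<open>{u, v}\<close> being represented by
  the two arcs \<open>(u, v)\<close> and \<open>(v, u)\<close>.
\<close>

definition uedges :: "'a pair_pre_digraph \<Rightarrow> 'a set set" where
  "uedges G = (\<lambda>(u, v). {u, v}) ` parcs G"

text \<open>Because every edge is present in both directions, the degree is the out-degree.\<close>

definition vdeg :: "'a pair_pre_digraph \<Rightarrow> 'a \<Rightarrow> nat" where
  "vdeg G v = out_degree (with_proj G) v"

definition perfect_matching :: "'a pair_pre_digraph \<Rightarrow> 'a set set \<Rightarrow> bool" where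
  "perfect_matching G M \<longleftrightarrow> M \<subseteq> uedges G \<and> (\<forall>v \<in> pverts G. \<exists>!e. e \<in> M \<and> v \<in> e)"

text \<open>
  The bound on the length excludes the walks \<open>(u, v), (v, u)\<close>, which traverse a single edge
  back and forth and count as cycles of the digraph.
\<close>

definition ucycle :: "'a pair_pre_digraph \<Rightarrow> ('a \<times> 'a) awalk \<Rightarrow> bool" where
  "ucycle G p \<longleftrightarrow> pre_digraph.cycle (with_proj G) p \<and> 3 \<le> length p"

definition girth :: "'a pair_pre_digraph \<Rightarrow> nat" where
  "girth G = (LEAST k. \<exists>p. ucycle G p \<and> length p = k)"

definition unicyclic :: "'a pair_pre_digraph \<Rightarrow> bool" where
  "unicyclic G \<longleftrightarrow>
     pair_graph G \<and> Digraph_Component.connected (with_proj G) \<and> card (uedges G) = card (pverts G)"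

text \<open>Sun graph of order \<open>2 * m\<close>: \<open>Inl i\<close> are the cycle vertices, \<open>Inr i\<close> the pendant ones.\<close>

definition sun_graph :: "nat \<Rightarrow> (nat + nat) pair_pre_digraph" where
  "sun_graph m = \<lparr>
     pverts = Inl ` {..<m} \<union> Inr ` {..<m},
     parcs = {(Inl i, Inl j) | i j. i < m \<and> j < m \<and> (j = Suc i mod m \<or> i = Suc j mod m)}
           \<union> {(Inl i, Inr i) | i. i < m} \<union> {(Inr i, Inl i) | i. i < m} \<rparr>"

definition broken_sun :: "'a pair_pre_digraph \<Rightarrow> bool" where
  "broken_sun G \<longleftrightarrow> unicyclic G \<and>
     (\<exists>m \<ge> 3. \<exists>H. subgraph (with_proj H) (with_proj (sun_graph m))
                    \<and> digraph_iso (with_proj G) (with_proj H))"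

text \<open>
  A cycle \<open>p\<close> may be started at any of its vertices and traversed in either direction, so the
  decompositions \<open>x # ys @ y # zs\<close> of its vertex sequence range over all segments of the cycle from
  a degree-3 vertex \<open>x\<close> to the next degree-3 vertex \<open>y\<close>; \<open>ys\<close> lists the vertices
  strictly in between.
\<close>

definition odd_deg2_gaps :: "'a pair_pre_digraph \<Rightarrow> bool" where
  "odd_deg2_gaps G \<longleftrightarrow>
     (\<forall>p x ys y zs.
        ucycle G p \<and> pre_digraph.awalk_verts (with_proj G) x p = x # ys @ y # zs \<and>
        x \<noteq> y \<and> vdeg G x = 3 \<and> vdeg G y = 3 \<and> (\<forall>w \<in> set ys. vdeg G w \<noteq> 3)
        \<longrightarrow> odd (card {w \<in> set ys. vdeg G w = 2}))"

definition one_edge_connection ::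
    "'a pair_pre_digraph \<Rightarrow> 'a pair_pre_digraph \<Rightarrow> 'a pair_pre_digraph \<Rightarrow> bool" where
  "one_edge_connection G1 G2 G \<longleftrightarrow>
     pair_graph G \<and> pverts G1 \<inter> pverts G2 = {} \<and> pverts G = pverts G1 \<union> pverts G2 \<and>
     (\<exists>u \<in> pverts G1. \<exists>v \<in> pverts G2. uedges G = uedges G1 \<union> uedges G2 \<union> {{u, v}})"

text \<open>Matrices are formed with respect to an enumeration \<open>vs\<close> of the vertices.\<close>

definition degree_mat :: "'a pair_pre_digraph \<Rightarrow> 'a list \<Rightarrow> real mat" where
  "degree_mat G vs = mat_diag (length vs) (\<lambda>i. real (vdeg G (vs ! i)))"

definition adjacency_mat :: "'a pair_pre_digraph \<Rightarrow> 'a list \<Rightarrow> real mat" where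
  "adjacency_mat G vs =
     mat (length vs) (length vs) (\<lambda>(i, j). if {vs ! i, vs ! j} \<in> uedges G then 1 else 0)"

definition laplacian_mat :: "'a pair_pre_digraph \<Rightarrow> 'a list \<Rightarrow> real mat" where
  "laplacian_mat G vs = degree_mat G vs - adjacency_mat G vs"

end

theory Submission
  imports Defs "HOL-Number_Theory.Cong"
begin

text \<open>
  Number the cycle of a broken sun graph cyclically from a vertex of degree \<open>3\<close>. Since all gaps are
  odd, every vertex of degree \<open>3\<close> has an even number, and because the length of the cycle is
  divisible by \<open>4\<close>, the function that takes the values \<open>0, 1, 0, -1\<close> periodically on the cycle and
  vanishes on the pendant vertices is well defined; it is an eigenvector of the Laplacian for the
  eigenvalue \<open>2\<close>. The missing perfect matching only serves to exclude the bare cycle. Multiples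
  of the two eigenvectors that agree at the two ends of the connecting edge glue to an eigenvector of
  the one-edge connection, because that edge then contributes nothing.
\<close>

section \<open>The Laplacian as an operator on functions\<close>

text \<open>This is the action of \<open>L\<close> on functions, degree times \<open>f v\<close>
  minus the neighbour sum, with the degree spread over the neighbours. In this form an edge with
  equal end values contributes nothing.\<close>

definition laplacian_op :: "'a pair_pre_digraph \<Rightarrow> ('a \<Rightarrow> real) \<Rightarrow> 'a \<Rightarrow> real" where
  "laplacian_op G f v = (\<Sum>w \<in> parcs G `` {v}. f v - f w)"

lemma vdeg_eq_card_neighbours: "vdeg G v = card (parcs G `` {v})"
proof -
  have "out_arcs (with_proj G) v = Pair v ` (parcs G `` {v})"
    by (force simp: out_arcs_def)
  then show ?thesis
    by (simp add: vdeg_def out_degree_def card_image inj_on_def)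
qed

lemma (in pair_graph) uedges_iff: "{v, w} \<in> uedges G \<longleftrightarrow> (v, w) \<in> parcs G"
proof
  assume "{v, w} \<in> uedges G"
  then obtain x y where "{v, w} = {x, y}" "(x, y) \<in> parcs G" by (auto simp: uedges_def)
  then show "(v, w) \<in> parcs G" by (auto simp: doubleton_eq_iff intro: arcs_symmetric)
next
  assume "(v, w) \<in> parcs G"
  then show "{v, w} \<in> uedges G" unfolding uedges_def by (rule rev_image_eqI) simp
qed

lemma (in pair_graph) finite_neighbours: "finite (parcs G `` {v})"
  using pair_finite_arcs by (rule finite_Image)

lemma (in pair_graph) neighbours_subset: "parcs G `` {v} \<subseteq> pverts G"
  by (auto dest: in_arcsD2)

text \<open>Row \<open>i\<close> of the matrix times the vector of values is
  \<open>laplacian_op\<close> at \<open>vs ! i\<close>, so eigenfunctions can replace eigenvectors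
  in all other arguments.\<close>

lemma (in pair_graph) eigenvalue_laplacian_mat:
  assumes "distinct vs" and vs: "set vs = pverts G"
    and f: "\<And>v. v \<in> pverts G \<Longrightarrow> laplacian_op G f v = k * f v"
    and nz: "v0 \<in> pverts G" "f v0 \<noteq> 0"
  shows "eigenvalue (laplacian_mat G vs) k"
proof -
  let ?n = "length vs" and ?L = "laplacian_mat G vs"
  define x where "x = vec ?n (\<lambda>i. f (vs ! i))"
  have dim: "dim_row ?L = ?n" "dim_col ?L = ?n"
    by (simp_all add: laplacian_mat_def degree_mat_def adjacency_mat_def)
  have entry: "?L $$ (i, j) = (if i = j then real (vdeg G (vs ! i)) else 0)
        - (if (vs ! i, vs ! j) \<in> parcs G then 1 else 0)" if "i < ?n" "j < ?n" for i j
    using that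
    by (simp add: laplacian_mat_def degree_mat_def adjacency_mat_def mat_diag_def uedges_iff)
  have "?L *\<^sub>v x = k \<cdot>\<^sub>v x"
  proof (rule eq_vecI)
    show "dim_vec (?L *\<^sub>v x) = dim_vec (k \<cdot>\<^sub>v x)"
      by (simp add: dim x_def)
  next
    fix i assume "i < dim_vec (k \<cdot>\<^sub>v x)"
    then have i: "i < ?n" by (simp add: x_def)
    let ?v = "vs ! i"
    have v: "?v \<in> pverts G" using i vs nth_mem by metis
    have "(?L *\<^sub>v x) $ i = (\<Sum>j<?n. ?L $$ (i, j) * f (vs ! j))"
      using i by (simp add: scalar_prod_def dim x_def atLeast0LessThan)
    also have "\<dots> = (\<Sum>j<?n. (if i = j then real (vdeg G ?v) * f ?v else 0)
        - (if (?v, vs ! j) \<in> parcs G then f (vs ! j) else 0))"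
      by (rule sum.cong) (auto simp: entry i algebra_simps)
    also have "\<dots> = real (vdeg G ?v) * f ?v
        - (\<Sum>j<?n. if (?v, vs ! j) \<in> parcs G then f (vs ! j) else 0)"
      using i by (simp add: sum_subtractf)
    \<comment> \<open>Reindexing from positions to vertices; \<open>distinct vs\<close> gives each
      vertex a single position.\<close>
    also have "(\<Sum>j<?n. if (?v, vs ! j) \<in> parcs G then f (vs ! j) else 0)
        = (\<Sum>w\<in>set vs. if (?v, w) \<in> parcs G then f w else 0)"
      using sum.reindex_bij_betw[OF bij_betw_nth[OF \<open>distinct vs\<close> refl refl]] .
    also have "\<dots> = (\<Sum>w \<in> parcs G `` {?v}. f w)"
      using neighbours_subset[of ?v]
      by (intro sum.mono_neutral_cong_right) (auto simp: vs)
    also have "real (vdeg G ?v) * f ?v - \<dots> = laplacian_op G f ?v"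
      by (simp add: laplacian_op_def sum_subtractf vdeg_eq_card_neighbours)
    finally show "(?L *\<^sub>v x) $ i = (k \<cdot>\<^sub>v x) $ i"
      using f[OF v] i by (simp add: x_def)
  qed
  moreover obtain i where "i < ?n" "vs ! i = v0"
    using nz(1) vs by (metis in_set_conv_nth)
  then have "x \<noteq> 0\<^sub>v ?n"
    using nz(2) by (auto simp: x_def dest: arg_cong[where f = "\<lambda>y. y $ i"])
  moreover have "x \<in> carrier_vec ?n"
    by (simp add: x_def)
  ultimately show ?thesis
    by (auto simp: eigenvalue_def eigenvector_def dim)
qed

text \<open>Arcs at \<open>x\<close> outside \<open>A\<close> join equal values, so their summands
  vanish; the remaining ones are \<open>a\<close> times those of \<open>g\<close>.\<close>

lemma laplacian_op_extend:
  assumes "finite (parcs G `` {x})" and "parcs A `` {x} \<subseteq> parcs G `` {x}"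
    and "\<And>w. (x, w) \<in> parcs G \<Longrightarrow> (x, w) \<notin> parcs A \<Longrightarrow> f w = f x"
    and "\<And>w. (x, w) \<in> parcs A \<Longrightarrow> f w = a * g w"
    and "f x = a * g x"
  shows "laplacian_op G f x = a * laplacian_op A g x"
proof -
  have "laplacian_op G f x = (\<Sum>w \<in> parcs A `` {x}. a * (g x - g w))"
    unfolding laplacian_op_def
    using assms by (intro sum.mono_neutral_cong_right) (auto simp: right_diff_distrib)
  then show ?thesis
    by (simp add: laplacian_op_def sum_distrib_left)
qed

section \<open>Gluing eigenfunctions along the connecting edge\<close>

lemma one_edge_connection_parcs:
  assumes "pair_graph G1" "pair_graph G2" "pair_graph G"
    and E: "uedges G = uedges G1 \<union> uedges G2 \<union> {{u, v}}"
  shows "parcs G = parcs G1 \<union> parcs G2 \<union> {(u, v), (v, u)}"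
proof -
  have "(x, y) \<in> parcs G \<longleftrightarrow> (x, y) \<in> parcs G1 \<or> (x, y) \<in> parcs G2 \<or> {x, y} = {u, v}" for x y
    using E assms(1-3)[THEN pair_graph.uedges_iff, of x y] by auto
  then show ?thesis
    by (auto simp: doubleton_eq_iff)
qed

lemma one_edge_connection_eigenfunction:
  assumes G12: "pair_graph G1" "pair_graph G2" and conn: "one_edge_connection G1 G2 G"
    and f1: "\<And>v. v \<in> pverts G1 \<Longrightarrow> laplacian_op G1 f1 v = k * f1 v"
      "v1 \<in> pverts G1" "f1 v1 \<noteq> 0"
    and f2: "\<And>v. v \<in> pverts G2 \<Longrightarrow> laplacian_op G2 f2 v = k * f2 v"
      "v2 \<in> pverts G2" "f2 v2 \<noteq> 0"
  obtains f v0 where "\<And>v. v \<in> pverts G \<Longrightarrow> laplacian_op G f v = k * f v"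
    "v0 \<in> pverts G" "f v0 \<noteq> 0"
proof -
  interpret G1: pair_graph G1 by fact
  interpret G2: pair_graph G2 by fact
  from conn obtain u v where G: "pair_graph G" and disj: "pverts G1 \<inter> pverts G2 = {}"
    and V: "pverts G = pverts G1 \<union> pverts G2" and u: "u \<in> pverts G1" and v: "v \<in> pverts G2"
    and E: "uedges G = uedges G1 \<union> uedges G2 \<union> {{u, v}}"
    unfolding one_edge_connection_def by blast
  interpret G: pair_graph G by fact
  have arcs: "parcs G = parcs G1 \<union> parcs G2 \<union> {(u, v), (v, u)}"
    using one_edge_connection_parcs[OF G12 G E] .
  \<comment> \<open>If the end values are not both 0, \<open>a = f2 v\<close> and
    \<open>b = f1 u\<close> will do; otherwise any pair other than 0, 0 does.\<close>
  obtain a b where ab: "a * f1 u = b * f2 v" "a \<noteq> 0 \<or> b \<noteq> 0"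
    by (metis mult.commute mult_zero_left mult_zero_right zero_neq_one)
  define f where "f x = (if x \<in> pverts G1 then a * f1 x else b * f2 x)" for x
  have f_1: "f x = a * f1 x" if "x \<in> pverts G1" for x
    using that by (simp add: f_def)
  have f_2: "f x = b * f2 x" if "x \<in> pverts G2" for x
    using that disj by (auto simp: f_def)
  have fuv: "f u = f v"
    using ab f_1[OF u] f_2[OF v] by simp
  have "laplacian_op G f x = k * f x" if "x \<in> pverts G" for x
  proof (cases "x \<in> pverts G1")
    case True
    have "laplacian_op G f x = a * laplacian_op G1 f1 x"
    proof (rule laplacian_op_extend[OF G.finite_neighbours])
      fix w assume "(x, w) \<in> parcs G" "(x, w) \<notin> parcs G1"
      then show "f w = f x"
        using True disj v fuv by (auto simp: arcs dest: G2.in_arcsD1)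
    qed (use True in \<open>auto simp: arcs f_1 dest: G1.in_arcsD2\<close>)
    then show ?thesis
      using True by (simp add: f1 f_1)
  next
    case False
    then have x: "x \<in> pverts G2" using that V by auto
    have "laplacian_op G f x = b * laplacian_op G2 f2 x"
    proof (rule laplacian_op_extend[OF G.finite_neighbours])
      fix w assume "(x, w) \<in> parcs G" "(x, w) \<notin> parcs G2"
      then show "f w = f x"
        using x disj u fuv by (auto simp: arcs dest: G1.in_arcsD1)
    qed (use x in \<open>auto simp: arcs f_2 dest: G2.in_arcsD2\<close>)
    then show ?thesis
      using x by (simp add: f2 f_2)
  qed
  \<comment> \<open>One scalar may be 0; the other keeps the glued function nonzero on its own
    side.\<close>
  moreover have "\<exists>v0 \<in> pverts G. f v0 \<noteq> 0"
    using ab(2) f1(2,3) f2(2,3) V by (metis UnCI f_1 f_2 mult_eq_0_iff)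
  ultimately show ?thesis
    using that by blast
qed

section \<open>Cycles with pendant vertices\<close>

text \<open>An abstract broken sun: a chordless cycle of length \<open>m\<close> with at most one
  pendant vertex at each cycle vertex. The numbering \<open>c\<close> is periodic on all naturals,
  so that walking around the cycle needs no wrap-around case.\<close>

locale cycle_with_pendants = pair_graph G for G :: "'a pair_pre_digraph" +
  fixes m :: nat and c :: "nat \<Rightarrow> 'a"
  assumes m_ge_3: "3 \<le> m"
    and c_eq_iff: "c i = c j \<longleftrightarrow> i mod m = j mod m"
    and c_arc: "(c i, c (Suc i)) \<in> parcs G"
    and c_chord: "(c i, c j) \<in> parcs G \<Longrightarrow> c j = c (Suc i) \<or> c i = c (Suc j)"
    and pendant: "v \<in> pverts G \<Longrightarrow> v \<notin> range c \<Longrightarrow> \<exists>i. parcs G `` {v} = {c i}"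
    and pendant_unique: "(c i, v) \<in> parcs G \<Longrightarrow> (c i, w) \<in> parcs G \<Longrightarrow>
          v \<notin> range c \<Longrightarrow> w \<notin> range c \<Longrightarrow> v = w"
begin

section \<open>Numbering and neighbourhoods on the cycle\<close>

lemma Suc_mod_eq_iff: "Suc i mod m = Suc j mod m \<longleftrightarrow> i mod m = j mod m"
  using cong_add_rcancel_nat[of i 1 j m] by (simp add: cong_def)

lemma c_Suc_eq_iff: "c (Suc i) = c (Suc j) \<longleftrightarrow> c i = c j"
  by (simp add: c_eq_iff Suc_mod_eq_iff)

lemma c_add_period: "c (i + m) = c i"
  by (simp add: c_eq_iff)

text \<open>Writing a cycle vertex with a successor index gives it a predecessor \<open>c j\<close>
  even when its own index is 0.\<close>

lemma c_pred: "\<exists>j. c i = c (Suc j)"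
proof
  show "c i = c (Suc (i + m - 1))"
    using m_ge_3 c_add_period[of i] by simp
qed

lemma c_in_verts: "c i \<in> pverts G"
  using c_arc by (rule in_arcsD1)

text \<open>Indices of equal vertices differ by a multiple of \<open>m\<close>, and a window of
  length at most \<open>m\<close> has no room for a positive one.\<close>

lemma inj_on_c: "b \<le> a + m \<Longrightarrow> inj_on c {a..<b}"
proof (rule linorder_inj_onI)
  fix i j assume "b \<le> a + m" "i < j" "i \<in> {a..<b}" "j \<in> {a..<b}"
  then have "0 < j - i" "j - i < m" by auto
  then show "c i \<noteq> c j"
    using \<open>i < j\<close> by (auto simp: c_eq_iff dest!: mod_eq_dvd_iff_nat[THEN iffD1, rotated, OF sym] dvd_imp_le)
qed auto

lemma c_neq_Suc_Suc: "c i \<noteq> c (Suc (Suc i))"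
  using inj_on_c[of "i + 3" i] m_ge_3 by (auto dest!: inj_onD[where x = i and y = "i + 2"])

lemma neighbours_on_cycle: "parcs G `` {c (Suc i)} \<inter> range c = {c i, c (Suc (Suc i))}"
  using c_arc[of i] c_arc[of "Suc i"] c_chord[of "Suc i"]
  by (auto simp: c_Suc_eq_iff intro: arcs_symmetric) (metis c_Suc_eq_iff)+

text \<open>The absence of chords leaves exactly two neighbours on the cycle, and
  \<open>pendant_unique\<close> allows at most one off it.\<close>

lemma neighbours_cycle:
  obtains "parcs G `` {c (Suc i)} = {c i, c (Suc (Suc i))}" "vdeg G (c (Suc i)) = 2"
  | v where "parcs G `` {c (Suc i)} = {c i, c (Suc (Suc i)), v}" "v \<in> pverts G" "v \<notin> range c"
      "vdeg G (c (Suc i)) = 3"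
proof (cases "parcs G `` {c (Suc i)} \<subseteq> range c")
  case True
  then have "parcs G `` {c (Suc i)} = {c i, c (Suc (Suc i))}"
    using neighbours_on_cycle[of i] by auto
  then show ?thesis
    using that(1) c_neq_Suc_Suc[of i] by (simp add: vdeg_eq_card_neighbours)
next
  case False
  then obtain v where v: "(c (Suc i), v) \<in> parcs G" "v \<notin> range c" by auto
  then have "parcs G `` {c (Suc i)} - range c = {v}"
    by (auto dest: pendant_unique)
  then have "parcs G `` {c (Suc i)} = {c i, c (Suc (Suc i))} \<union> {v}"
    using Int_Diff_Un[of "parcs G `` {c (Suc i)}" "range c"] by (simp only: neighbours_on_cycle)
  then have "parcs G `` {c (Suc i)} = {c i, c (Suc (Suc i)), v}"
    by auto
  moreover have "v \<noteq> c i" "v \<noteq> c (Suc (Suc i))" using v(2) by auto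
  ultimately show ?thesis
    using that(2) c_neq_Suc_Suc[of i] v in_arcsD2[OF v(1)] by (simp add: vdeg_eq_card_neighbours)
qed

lemma vdeg_cycle: "vdeg G (c i) = 2 \<or> vdeg G (c i) = 3"
  using c_pred[of i] neighbours_cycle by metis

text \<open>A pendant vertex raises the degree of its neighbour to 3. This yields a vertex of degree
  3 to number from, and later places pendant vertices next to evenly numbered ones only.\<close>

lemma pendant_neighbour:
  assumes "v \<in> pverts G" "v \<notin> range c"
  obtains i where "parcs G `` {v} = {c i}" "vdeg G (c i) = 3"
proof -
  obtain i where i: "parcs G `` {v} = {c i}"
    using pendant[OF assms] by blast
  then have "(c i, v) \<in> parcs G" by (auto intro: arcs_symmetric)
  moreover obtain j where "c i = c (Suc j)" using c_pred by blast
  ultimately have "vdeg G (c i) = 3"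
    using assms(2) by (cases rule: neighbours_cycle[of j]) auto
  with i show ?thesis using that by blast
qed

text \<open>Allows a chosen vertex of degree 3 to receive number 0.\<close>

lemma cycle_with_pendants_shift: "cycle_with_pendants G m (\<lambda>i. c (a + i))"
proof
  have range: "range (\<lambda>i. c (a + i)) = range c"
  proof -
    \<comment> \<open>Adding \<open>a * (m - 1)\<close> undoes the shift by \<open>a\<close> modulo
      \<open>m\<close>.\<close>
    have "c i = c (a + (i + a * (m - 1)))" for i
    proof -
      have "a + (i + a * (m - 1)) = i + a * m"
        using m_ge_3 by (cases m) auto
      then show ?thesis by (simp only: c_eq_iff mod_mult_self1)
    qed
    then show ?thesis by (auto simp: image_iff)
  qed
  show "c (a + i) = c (a + j) \<longleftrightarrow> i mod m = j mod m" for i j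
    using cong_add_lcancel_nat[of a i j m] by (simp add: c_eq_iff cong_def)
  show "\<exists>i. parcs G `` {v} = {c (a + i)}"
    if "v \<in> pverts G" "v \<notin> range (\<lambda>i. c (a + i))" for v
    using pendant[of v] that range by (metis (no_types, lifting) rangeE rangeI)
  show "v = w" if "(c (a + i), v) \<in> parcs G" "(c (a + i), w) \<in> parcs G"
    "v \<notin> range (\<lambda>i. c (a + i))" "w \<notin> range (\<lambda>i. c (a + i))" for i v w
    using that pendant_unique unfolding range by blast
qed (use m_ge_3 c_arc[of "a + _"] c_chord[of "a + _" "a + _"] in auto)

subsection \<open>The girth\<close>

lemma pawalk_verts_cycle:
  "pawalk_verts (c a) (map (\<lambda>i. (c i, c (Suc i))) [a..<a + n]) = map c [a..<Suc (a + n)]"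
proof (induction n arbitrary: a)
  case (Suc n)
  then show ?case
    using Suc[of "Suc a"] by (simp add: upt_conv_Cons del: upt_Suc)
qed simp

lemma pcas_cycle: "pcas (c a) (map (\<lambda>i. (c i, c (Suc i))) [a..<a + n]) (c (a + n))"
proof (induction n arbitrary: a)
  case (Suc n)
  then show ?case
    using Suc[of "Suc a"] by (simp add: upt_conv_Cons del: upt_Suc)
qed simp

text \<open>The start \<open>a\<close> is free because the gap condition is later applied to the
  cycle started at a vertex of degree 3.\<close>

lemma ucycle_cycle: "ucycle G (map (\<lambda>i. (c i, c (Suc i))) [a..<a + m])"
proof -
  let ?p = "map (\<lambda>i. (c i, c (Suc i))) [a..<a + m]"
  have "awalk (c a) ?p (c a)"
    using c_in_verts pcas_cycle[of a m] by (auto simp: awalk_def c_add_period intro: c_arc)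
  moreover have "tl (pawalk_verts (c a) ?p) = map c [Suc a..<Suc (a + m)]"
    by (simp only: pawalk_verts_cycle map_tl[symmetric] tl_upt)
  then have "distinct (tl (pawalk_verts (c a) ?p))"
    using inj_on_c[of "Suc (a + m)" "Suc a"] by (simp add: distinct_map del: upt_Suc)
  moreover have "?p \<noteq> []"
    using m_ge_3 by simp
  ultimately show ?thesis
    unfolding ucycle_def cycle_def using m_ge_3 by auto
qed

text \<open>A vertex of \<open>p\<close> has two different neighbours on \<open>p\<close>, hence is
  not pendant; these two can then only be its predecessor and successor under \<open>c\<close>. So
  the vertices of \<open>p\<close> are closed under successors and comprise all \<open>m\<close>
  cycle vertices.\<close>

lemma length_ucycle_ge:
  assumes "ucycle G p"
  shows "m \<le> length p"
proof -
  let ?k = "length p"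
  obtain u where walk: "awalk u p u" and dist: "distinct (tl (pawalk_verts u p))"
    and k: "3 \<le> ?k"
    using assms unfolding ucycle_def cycle_def by blast
  have verts: "pawalk_verts u p = u # map snd p"
    using awalk_verts_conv'[of u p u] walk by (auto simp: awalk_def hd_map cas_simp)
  \<comment> \<open>The heads of the arcs of \<open>p\<close>, read cyclically, so that consecutive
    values are adjacent across the end of \<open>p\<close> as well.\<close>
  define y where "y j = snd (p ! (j mod ?k))" for j
  have y_mem: "y j \<in> set (map snd p)" for j
  proof -
    have "j mod ?k < ?k" using k by (intro mod_less_divisor) auto
    then show ?thesis unfolding y_def by simp
  qed
  have verts': "pawalk_verts u p = map fst p @ [snd (last p)]"
    using awalk_verts_conv[of u p] k by auto
  have step: "fst (p ! Suc i) = snd (p ! i)" if "Suc i < ?k" for i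
    using arg_cong[OF trans[OF sym[OF verts] verts'], of "\<lambda>l. l ! Suc i"] that
    by (simp add: nth_append)
  have wrap: "fst (p ! 0) = snd (p ! (?k - 1))"
  proof -
    have "u = fst (p ! 0)"
      using arg_cong[OF trans[OF sym[OF verts] verts'], of "\<lambda>l. l ! 0"] k
      by (cases p) auto
    moreover have "u = snd (last p)"
      using walk verts' by (auto elim!: awalkE)
    ultimately show ?thesis
      using last_conv_nth[of p] k by (cases "p = []") auto
  qed
  have y_arc: "(y j, y (Suc j)) \<in> parcs G" for j
  proof -
    have "y j = fst (p ! (Suc j mod ?k))"
    proof (cases "Suc (j mod ?k) < ?k")
      case True
      then have "Suc j mod ?k = Suc (j mod ?k)" by (simp add: mod_Suc)
      with step[OF True] show ?thesis by (simp add: y_def)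
    next
      case False
      moreover have "j mod ?k < ?k" using k by (intro mod_less_divisor) auto
      ultimately have "j mod ?k = ?k - 1" "Suc j mod ?k = 0" by (auto simp: mod_Suc)
      with wrap show ?thesis by (simp add: y_def)
    qed
    moreover have "p ! (Suc j mod ?k) \<in> parcs G"
    proof -
      have "Suc j mod ?k < ?k" using k by (intro mod_less_divisor) auto
      then have "p ! (Suc j mod ?k) \<in> set p" by (rule nth_mem)
      then show ?thesis using walk by (auto simp: awalk_def)
    qed
    ultimately show ?thesis by (simp add: y_def)
  qed
  \<comment> \<open>Heads are distinct along \<open>p\<close>, and 2 is not a multiple of a length
    that is at least 3.\<close>
  have y_neq: "y j \<noteq> y (Suc (Suc j))" for j
  proof
    assume "y j = y (Suc (Suc j))"
    moreover have "distinct (map snd p)" using dist verts by simp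
    moreover have "i mod ?k < ?k" for i using k by (intro mod_less_divisor) auto
    ultimately have "j mod ?k = Suc (Suc j) mod ?k"
      using nth_eq_iff_index_eq[of "map snd p" "j mod ?k" "Suc (Suc j) mod ?k"]
      by (simp add: y_def)
    then show False
      using cong_add_lcancel_0_nat[of j 2 ?k] k by (simp add: cong_def)
  qed
  have y_nb: "{y j, y (Suc (Suc j))} \<subseteq> parcs G `` {y (Suc j)}" for j
    using y_arc[of j] y_arc[of "Suc j"] by (auto dest: arcs_symmetric)
  have on_cycle: "y (Suc j) \<in> range c" for j
  proof (rule ccontr)
    assume "y (Suc j) \<notin> range c"
    then obtain i where "parcs G `` {y (Suc j)} = {c i}"
      using pendant in_arcsD1[OF y_arc] by blast
    then show False using y_nb[of j] y_neq[of j] by auto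
  qed
  \<comment> \<open>A full turn presents any index as a double successor, so facts about
    \<open>y (Suc j)\<close> cover all values.\<close>
  have y_period: "y j = y (Suc (Suc (j + ?k - 2)))" for j
  proof -
    have "Suc (Suc (j + ?k - 2)) = j + ?k" using k by simp
    then show ?thesis unfolding y_def by simp
  qed
  have y_range: "y j \<in> range c" for j
    using on_cycle y_period by metis
  have closed: "c (Suc i) \<in> range y" if ci: "c i \<in> range y" for i
  proof -
    obtain i' where i': "c i = c (Suc i')" using c_pred by blast
    obtain l where "c i = y l" using ci by auto
    then obtain j where j: "c (Suc i') = y (Suc j)"
      using i' y_period[of l] by simp
    have "{y j, y (Suc (Suc j))} \<subseteq> parcs G `` {c (Suc i')} \<inter> range c"
      unfolding j using y_nb[of j] y_range by auto
    then have "{y j, y (Suc (Suc j))} \<subseteq> {c i', c (Suc (Suc i'))}"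
      by (simp only: neighbours_on_cycle)
    \<comment> \<open>Two different elements exhaust a two-element set, so the successor is one of
      them.\<close>
    then have "c (Suc (Suc i')) \<in> range y"
      using y_neq[of j] by (auto intro: range_eqI sym)
    then show ?thesis using i' c_Suc_eq_iff[of i "Suc i'"] by simp
  qed
  obtain i0 where i0: "c i0 \<in> range y" using y_range by (metis imageE rangeI)
  have "c (i0 + n) \<in> range y" for n
    by (induction n) (use i0 closed in auto)
  then have c_mem: "c (i0 + n) \<in> set (map snd p)" for n
    using y_mem by (metis rangeE)
  have "c ` {i0..<i0 + m} \<subseteq> set (map snd p)"
  proof (rule image_subsetI)
    fix i assume "i \<in> {i0..<i0 + m}"
    then show "c i \<in> set (map snd p)" using c_mem[of "i - i0"] by simp
  qed
  then have "card (c ` {i0..<i0 + m}) \<le> card (set (map snd p))"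
    by (intro card_mono) auto
  also have "\<dots> \<le> ?k"
    using card_length[of "map snd p"] by simp
  finally show ?thesis
    using inj_on_c[of "i0 + m" i0] by (simp add: card_image)
qed

lemma girth_eq: "girth G = m"
  unfolding girth_def
proof (rule Least_equality)
  show "\<exists>p. ucycle G p \<and> length p = m"
    using ucycle_cycle[of 0] by (intro exI conjI) auto
qed (use length_ucycle_ge in blast)

subsection \<open>The eigenfunction\<close>

text \<open>For even \<open>m\<close> the parity of an index is determined by its vertex, so the
  chosen edges, every second one around the cycle, do not overlap.\<close>

lemma perfect_matching_cycle:
  assumes "even m" and V: "pverts G \<subseteq> range c"
  shows "perfect_matching G (range (\<lambda>i. {c (2 * i), c (Suc (2 * i))}))"
  unfolding perfect_matching_def
proof (intro conjI ballI)
  show "range (\<lambda>i. {c (2 * i), c (Suc (2 * i))}) \<subseteq> uedges G"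
    using c_arc by (auto simp: uedges_iff)
next
  let ?M = "range (\<lambda>i. {c (2 * i), c (Suc (2 * i))})"
  fix v assume "v \<in> pverts G"
  then obtain j where v: "v = c j" using V by auto
  \<comment> \<open>The even index at which the matching edge through \<open>c j\<close>
    starts.\<close>
  let ?d = "2 * (j div 2)"
  have parity: "even i \<longleftrightarrow> even j" if "c i = c j" for i j
    using that \<open>even m\<close> dvd_mod_iff[of 2 m i] dvd_mod_iff[of 2 m j] by (simp add: c_eq_iff)
  have "{c (2 * i), c (Suc (2 * i))} = {c ?d, c (Suc ?d)}"
    if "c j \<in> {c (2 * i), c (Suc (2 * i))}" for i
  proof (cases "even j")
    case True
    then have "c j \<noteq> c (Suc (2 * i))" "?d = j" using parity[of "Suc (2 * i)" j] by auto
    then have "c j = c (2 * i)" "?d = j" using that by auto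
    then show ?thesis using c_Suc_eq_iff[of j "2 * i"] by simp
  next
    case False
    then have "c j \<noteq> c (2 * i)" "Suc ?d = j" using parity[of "2 * i" j] by auto
    then have "c j = c (Suc (2 * i))" "Suc ?d = j" using that by auto
    then show ?thesis using c_Suc_eq_iff[of ?d "2 * i"] by auto
  qed
  moreover have "c j \<in> {c ?d, c (Suc ?d)}"
    by (cases "even j") auto
  ultimately show "\<exists>!e. e \<in> ?M \<and> v \<in> e"
    unfolding v by (intro ex1I[of _ "{c ?d, c (Suc ?d)}"]) blast+
qed

text \<open>Strong induction within one period: between consecutive degree-3 positions
  \<open>j < i\<close> lie \<open>i - j - 1\<close> vertices, all of degree 2. That number is odd,
  so \<open>i\<close> and \<open>j\<close> have the same parity.\<close>

lemma even_if_vdeg_3: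
  assumes "even m" and "odd_deg2_gaps G" and c0: "vdeg G (c 0) = 3" and "vdeg G (c i) = 3"
  shows "even i"
proof -
  have "even i" if "i < m" "vdeg G (c i) = 3" for i
    using that
  proof (induction i rule: less_induct)
    case (less i)
    show ?case
    proof (cases "i = 0")
      case False
      \<comment> \<open>The last degree-3 position before \<open>i\<close>; position 0 is a
        candidate.\<close>
      define j where "j = (GREATEST j. j < i \<and> vdeg G (c j) = 3)"
      have j: "j < i" "vdeg G (c j) = 3"
        and max: "\<And>l. l < i \<Longrightarrow> vdeg G (c l) = 3 \<Longrightarrow> l \<le> j"
        using GreatestI_nat[of "\<lambda>j. j < i \<and> vdeg G (c j) = 3" 0 i]
          Greatest_le_nat[of "\<lambda>j. j < i \<and> vdeg G (c j) = 3" _ i] False c0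
        by (auto simp: j_def)
      \<comment> \<open>Starting the cycle at \<open>c j\<close> makes the gap an initial segment of
        its vertex sequence.\<close>
      let ?p = "map (\<lambda>i. (c i, c (Suc i))) [j..<j + m]"
      have "[j..<Suc (j + m)] = j # [Suc j..<i] @ i # [Suc i..<Suc (j + m)]"
        using j(1) less.prems(1) upt_add_eq_append[of "Suc j" i "Suc (j + m) - i"]
        by (simp add: upt_conv_Cons del: upt_Suc)
      then have verts: "pawalk_verts (c j) ?p =
          c j # map c [Suc j..<i] @ c i # map c [Suc i..<Suc (j + m)]"
        by (simp add: pawalk_verts_cycle del: upt_Suc)
      have deg2: "vdeg G w = 2" if "w \<in> set (map c [Suc j..<i])" for w
        using that max vdeg_cycle by fastforce
      have "c j \<noteq> c i"
        using inj_on_c[of m 0] j(1) less.prems(1) by (auto dest: inj_onD)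
      then have "odd (card {w \<in> set (map c [Suc j..<i]). vdeg G w = 2})"
        using \<open>odd_deg2_gaps G\<close>[unfolded odd_deg2_gaps_def awalk_verts_with_proj_eq, rule_format,
            of ?p "c j" "map c [Suc j..<i]" "c i" "map c [Suc i..<Suc (j + m)]"]
          ucycle_cycle[of j] verts j(2) less.prems(2) deg2
        by (simp del: upt_Suc)
      moreover have "{w \<in> set (map c [Suc j..<i]). vdeg G w = 2} = c ` {Suc j..<i}"
        using deg2 by auto
      moreover have "card (c ` {Suc j..<i}) = i - Suc j"
        using inj_on_c[of i "Suc j"] less.prems(1) by (simp add: card_image)
      ultimately have "odd (i - Suc j)" by simp
      moreover have "even j"
        using less.IH[of j] j less.prems(1) by simp
      ultimately show ?thesis
        using j(1) by simp
    qed simp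
  qed
  \<comment> \<open>Passing to the index below \<open>m\<close> keeps the parity, since
    \<open>m\<close> is even.\<close>
  moreover have "c (i mod m) = c i" "i mod m < m"
    using m_ge_3 by (auto simp: c_eq_iff)
  ultimately show ?thesis
    using assms(1,4) dvd_mod_iff[of 2 m i] by metis
qed

lemma eigenfunction_if_vdeg_3:
  assumes m: "m mod 4 = 0" and "odd_deg2_gaps G" and "vdeg G (c 0) = 3"
  shows "\<exists>f. (\<forall>v\<in>pverts G. laplacian_op G f v = 2 * f v) \<and> (\<exists>v\<in>pverts G. f v \<noteq> 0)"
proof -
  define h :: "nat \<Rightarrow> real" where
    "h i = (if i mod 4 = 1 then 1 else if i mod 4 = 3 then - 1 else 0)" for i
  \<comment> \<open>\<open>SOME\<close> picks an index of \<open>v\<close>, unique only modulo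
    \<open>m\<close>; as 4 divides \<open>m\<close>, the value of \<open>h\<close> does not depend
    on the choice.\<close>
  define f where "f v = (if v \<in> range c then h (SOME i. c i = v) else 0)" for v
  have "4 dvd m" using m by auto
  then have "even m" by (meson dvd_trans even_numeral)
  have f_c: "f (c i) = h i" for i
  proof -
    have "c (SOME j. c j = c i) = c i" by (rule someI) simp
    then have "(SOME j. c j = c i) mod 4 = i mod 4"
      using \<open>4 dvd m\<close> by (metis c_eq_iff mod_mod_cancel)
    then show ?thesis by (simp add: f_def h_def)
  qed
  have f_pendant: "f v = 0" if "v \<notin> range c" for v
    using that by (simp add: f_def)
  have h_even: "h i = 0" if "even i" for i
    using that dvd_mod_iff[of 2 4 i] by (auto simp: h_def)
  \<comment> \<open>The values at the two cycle neighbours cancel and pendant values are 0, so at a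
    cycle vertex the operator multiplies by the degree. For degree 2 that is the eigenvalue; for
    degree 3 the value itself is 0.\<close>
  have h_alt: "h i + h (Suc (Suc i)) = 0" for i
    using mod_less_divisor[of 4 i] by (auto simp: h_def mod_Suc)
  have deg3: "even i" if "vdeg G (c i) = 3" for i
    using even_if_vdeg_3 assms \<open>even m\<close> that by blast
  have "laplacian_op G f v = 2 * f v" if v: "v \<in> pverts G" for v
  proof (cases "v \<in> range c")
    case False
    then obtain i where "parcs G `` {v} = {c i}" "vdeg G (c i) = 3"
      using pendant_neighbour[OF v] by blast
    \<comment> \<open>A pendant vertex and its evenly numbered neighbour both have value 0.\<close>
    then show ?thesis
      using False by (simp add: laplacian_op_def f_pendant f_c deg3 h_even)
  next
    case True
    then obtain i where i: "v = c (Suc i)" using c_pred by blast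
    show ?thesis
    proof (cases rule: neighbours_cycle[of i])
      case 1
      then show ?thesis
        using c_neq_Suc_Suc[of i] h_alt[of i] by (simp add: laplacian_op_def i f_c)
    next
      case (2 w)
      then have "w \<noteq> c i" "w \<noteq> c (Suc (Suc i))" by auto
      then show ?thesis
        using 2 c_neq_Suc_Suc[of i] h_alt[of i] h_even[OF deg3[of "Suc i"]]
        by (simp add: laplacian_op_def i f_c f_pendant)
    qed
  qed
  moreover have "f (c 1) \<noteq> 0"
    by (simp add: f_c h_def)
  ultimately show ?thesis
    using c_in_verts by blast
qed

text \<open>An even cycle without pendant vertices would have a perfect matching, so a pendant
  vertex exists; its neighbour has degree 3 and becomes number 0.\<close>

lemma eigenfunction:
  assumes "\<nexists>M. perfect_matching G M" and g: "girth G mod 4 = 0" and "odd_deg2_gaps G"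
  shows "\<exists>f. (\<forall>v\<in>pverts G. laplacian_op G f v = 2 * f v) \<and> (\<exists>v\<in>pverts G. f v \<noteq> 0)"
proof -
  have m: "m mod 4 = 0" using g by (simp add: girth_eq)
  then have "even m" by presburger
  then obtain v where "v \<in> pverts G" "v \<notin> range c"
    using assms(1) perfect_matching_cycle by blast
  then obtain a where "vdeg G (c a) = 3"
    using pendant_neighbour by blast
  then show ?thesis
    using cycle_with_pendants.eigenfunction_if_vdeg_3[OF cycle_with_pendants_shift[of a] m assms(3)]
    by simp
qed

end

section \<open>Broken sun graphs\<close>

text \<open>The subgraph \<open>H\<close> may fail to be induced, so arcs transfer only from
  \<open>G\<close> to the sun graph.\<close>

lemma broken_sun_embedding:
  assumes "broken_sun G"
  obtains m \<phi> where "3 \<le> m" "inj_on \<phi> (pverts G)" "\<phi> ` pverts G \<subseteq> pverts (sun_graph m)"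
    "\<And>u v. (u, v) \<in> parcs G \<Longrightarrow> (\<phi> u, \<phi> v) \<in> parcs (sun_graph m)"
proof -
  obtain m H where m: "3 \<le> m" and sub: "subgraph (with_proj H) (with_proj (sun_graph m))"
    and iso: "digraph_iso (with_proj G) (with_proj H)"
    using assms unfolding broken_sun_def by blast
  obtain h where h: "pre_digraph.digraph_isomorphism (with_proj G) h"
    and H: "with_proj H = app_iso h (with_proj G)"
    using iso unfolding digraph_iso_def by blast
  have H_simps: "pverts H = iso_verts h ` pverts G" "parcs H = iso_arcs h ` parcs G"
    "iso_tail h = fst" "iso_head h = snd"
    using arg_cong[OF H, of verts] arg_cong[OF H, of arcs] arg_cong[OF H, of tail]
      arg_cong[OF H, of head] by auto
  have "(iso_verts h u, iso_verts h v) \<in> parcs (sun_graph m)" if "(u, v) \<in> parcs G" for u v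
  proof -
    \<comment> \<open>Tails and heads are the projections on both sides, so the arc map is the
      vertex map in each component.\<close>
    have "iso_arcs h (u, v) = (iso_verts h u, iso_verts h v)"
      using h that unfolding pre_digraph.digraph_isomorphism_def
      by (auto simp: H_simps prod_eq_iff)
    moreover have "iso_arcs h (u, v) \<in> parcs H"
      using that by (simp add: H_simps)
    ultimately show ?thesis
      using sub by (auto simp: subgraph_def)
  qed
  moreover have "inj_on (iso_verts h) (pverts G)"
    using h by (simp add: pre_digraph.digraph_isomorphism_def)
  moreover have "iso_verts h ` pverts G \<subseteq> pverts (sun_graph m)"
    using sub by (simp add: subgraph_def H_simps)
  ultimately show ?thesis
    using m that by blast
qed

text \<open>
  Each pendant vertex has at most one edge to the cycle, and each cycle vertex at most one edge to its
  successor. Since there are as many edges as vertices, all these edges are present; hence the cycle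
  vertices that occur are closed under successors, so the whole cycle occurs.
\<close>

lemma broken_sun_cycle_with_pendants:
  assumes "broken_sun G"
  shows "\<exists>m c. cycle_with_pendants G m c"
proof -
  obtain m \<phi> where m: "3 \<le> m" and inj: "inj_on \<phi> (pverts G)"
    and \<phi>_verts: "\<phi> ` pverts G \<subseteq> pverts (sun_graph m)"
    and \<phi>_arcs: "\<And>u v. (u, v) \<in> parcs G \<Longrightarrow> (\<phi> u, \<phi> v) \<in> parcs (sun_graph m)"
    by (rule broken_sun_embedding[OF assms]) (rule that, blast+)
  have uni: "unicyclic G" using assms by (simp add: broken_sun_def)
  interpret pair_graph G using uni by (simp add: unicyclic_def)
  let ?V = "pverts G"
  \<comment> \<open>Names the vertices of \<open>G\<close> by those of the sun graph; meaningful
    only where \<open>S\<close> holds.\<close>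
  define \<psi> where "\<psi> = the_inv_into ?V \<phi>"
  define S where "S x \<longleftrightarrow> x \<in> \<phi> ` ?V" for x
  have \<psi>\<phi>: "\<psi> (\<phi> v) = v" if "v \<in> ?V" for v
    using that inj by (simp add: \<psi>_def the_inv_into_f_f)
  have \<phi>\<psi>: "\<phi> (\<psi> x) = x" if "S x" for x
    using that inj by (simp add: \<psi>_def S_def f_the_inv_into_f)
  \<comment> \<open>\<open>C\<close> and \<open>P\<close> index the cycle and pendant vertices of
    the sun graph that occur in \<open>G\<close>; \<open>K\<close> and \<open>Q\<close> index those
    whose edge to the successor, respectively to the cycle, is present too.\<close>
  define C where "C = {i. S (Inl i)}"
  define P where "P = {i. S (Inr i)}"
  define K where "K = {i \<in> C. (\<psi> (Inl i), \<psi> (Inl (Suc i mod m))) \<in> parcs G \<and> Suc i mod m \<in> C}"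
  define Q where "Q = {i \<in> P. (\<psi> (Inl i), \<psi> (Inr i)) \<in> parcs G \<and> i \<in> C}"
  have C_le: "C \<subseteq> {..<m}" and P_le: "P \<subseteq> {..<m}"
    using \<phi>_verts by (auto simp: C_def P_def S_def sun_graph_def)
  then have fin: "finite C" "finite P" by (auto intro: finite_subset)
  have V_cases: "(\<exists>i\<in>C. v = \<psi> (Inl i)) \<or> (\<exists>i\<in>P. v = \<psi> (Inr i))" if "v \<in> ?V" for v
  proof -
    have "S (\<phi> v)" using that by (simp add: S_def)
    then show ?thesis
      using \<psi>\<phi>[OF that] by (cases "\<phi> v") (auto simp: C_def P_def intro: sym)
  qed
  \<comment> \<open>One orientation per edge, forwards along the cycle or outwards to a pendant
    vertex, so that \<open>card A\<close> bounds the number of edges.\<close>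
  define A where "A = (\<lambda>i. (\<psi> (Inl i), \<psi> (Inl (Suc i mod m)))) ` K
    \<union> (\<lambda>i. (\<psi> (Inl i), \<psi> (Inr i))) ` Q"
  have arc_cases: "(v, w) \<in> A \<or> (w, v) \<in> A" if vw: "(v, w) \<in> parcs G" for v w
  proof -
    have on_K: "(a, b) \<in> A"
      if "(a, b) \<in> parcs G" "\<phi> a = Inl i" "\<phi> b = Inl (Suc i mod m)" for a b i
      using that \<psi>\<phi>[of a] \<psi>\<phi>[of b] in_arcsD1[OF that(1)] in_arcsD2[OF that(1)]
      unfolding A_def by (intro UnI1 image_eqI[of _ _ i]) (simp_all add: K_def C_def S_def flip: that(2,3))
    have on_Q: "(a, b) \<in> A"
      if "(a, b) \<in> parcs G" "\<phi> a = Inl i" "\<phi> b = Inr i" for a b i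
      using that \<psi>\<phi>[of a] \<psi>\<phi>[of b] in_arcsD1[OF that(1)] in_arcsD2[OF that(1)]
      unfolding A_def by (intro UnI2 image_eqI[of _ _ i]) (simp_all add: Q_def C_def P_def S_def flip: that(2,3))
    consider i where "\<phi> v = Inl i" "\<phi> w = Inl (Suc i mod m)"
      | i where "\<phi> w = Inl i" "\<phi> v = Inl (Suc i mod m)"
      | i where "\<phi> v = Inl i" "\<phi> w = Inr i"
      | i where "\<phi> w = Inl i" "\<phi> v = Inr i"
      using \<phi>_arcs[OF vw] by (auto simp: sun_graph_def)
    then show ?thesis
      by cases (use on_K on_Q vw arcs_symmetric[OF vw] in blast)+
  qed
  have cardV: "card ?V = card C + card P"
  proof -
    have "\<phi> ` ?V = Inl ` C \<union> Inr ` P"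
    proof (rule subset_antisym; rule subsetI)
      show "x \<in> Inl ` C \<union> Inr ` P" if "x \<in> \<phi> ` ?V" for x
        using that by (cases x) (auto simp: C_def P_def S_def)
      show "x \<in> \<phi> ` ?V" if "x \<in> Inl ` C \<union> Inr ` P" for x
        using that by (auto simp: C_def P_def S_def)
    qed
    moreover have "card (Inl ` C \<union> Inr ` P) = card C + card P"
      using fin by (subst card_Un_disjoint) (auto simp: card_image)
    moreover have "card (\<phi> ` ?V) = card ?V"
      using inj by (rule card_image)
    ultimately show ?thesis by simp
  qed
  have finKQ: "finite K" "finite Q" using fin by (auto simp: K_def Q_def)
  have "uedges G \<subseteq> (\<lambda>(v, w). {v, w}) ` A"
  proof
    fix e assume "e \<in> uedges G"
    then obtain v w where "e = {v, w}" "(v, w) \<in> parcs G" by (auto simp: uedges_def)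
    then show "e \<in> (\<lambda>(v, w). {v, w}) ` A"
      using arc_cases[of v w] by (auto simp: insert_commute image_iff)
  qed
  then have "card (uedges G) \<le> card A"
    using finKQ by (intro surj_card_le) (auto simp: A_def)
  also have "\<dots> \<le> card K + card Q"
    unfolding A_def using finKQ by (intro order_trans[OF card_Un_le] add_mono card_image_le)
  \<comment> \<open>There are as many edges as vertices, so the inclusions of \<open>K\<close> in
    \<open>C\<close> and of \<open>Q\<close> in \<open>P\<close> must both be equalities.\<close>
  finally have "card C + card P \<le> card K + card Q"
    using uni cardV by (simp add: unicyclic_def)
  moreover have "K \<subseteq> C" "Q \<subseteq> P" by (auto simp: K_def Q_def)
  moreover from this have "card K \<le> card C" "card Q \<le> card P"
    using fin by (auto intro: card_mono)
  ultimately have KC: "K = C" and QP: "Q = P"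
    using card_subset_eq[OF fin(1), of K] card_subset_eq[OF fin(2), of Q] by auto
  have "?V \<noteq> {}"
    using uni by (auto simp: unicyclic_def Digraph_Component.connected_def strongly_connected_def)
  \<comment> \<open>If the vertex at hand is pendant, \<open>Q = P\<close> supplies its cycle
    vertex.\<close>
  then obtain i0 where i0: "i0 \<in> C"
    using V_cases QP by (auto simp: Q_def)
  have "(i0 + n) mod m \<in> C" for n
  proof (induction n)
    case 0
    then show ?case using i0 C_le by auto
  next
    case (Suc n)
    then have "Suc ((i0 + n) mod m) mod m \<in> C" using KC by (auto simp: K_def)
    then show ?case by (simp add: mod_Suc_eq)
  qed
  \<comment> \<open>This offset turns \<open>i0 + n\<close> into \<open>m + i\<close>, so every
    residue is reached.\<close>
  from this[of "m - i0 + i" for i] have C_all: "i mod m \<in> C" for i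
    using i0 C_le by auto
  define c where "c i = \<psi> (Inl (i mod m))" for i
  have \<phi>c: "\<phi> (c i) = Inl (i mod m)" for i
    using C_all by (auto simp: c_def C_def intro: \<phi>\<psi>)
  have c_lt: "\<psi> (Inl i) = c i" if "i < m" for i
    using that by (simp add: c_def)
  have c_Suc: "\<psi> (Inl (Suc i mod m)) = c (Suc i)" for i
    by (simp add: c_def)
  have Inr_notin: "\<psi> (Inr i) \<notin> range c" if "i \<in> P" for i
    using \<phi>c \<phi>\<psi>[of "Inr i"] that by (auto simp: P_def)
  have nb: "(\<exists>i. v = c i \<and> w = c (Suc i)) \<or> (\<exists>i. w = c i \<and> v = c (Suc i))
      \<or> (\<exists>i\<in>P. v = c i \<and> w = \<psi> (Inr i)) \<or> (\<exists>i\<in>P. w = c i \<and> v = \<psi> (Inr i))"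
    if "(v, w) \<in> parcs G" for v w
    using arc_cases[OF that] C_le P_le unfolding A_def KC QP
    by (auto simp: c_Suc c_lt subset_iff)
  have "cycle_with_pendants G m c"
  proof
    show "3 \<le> m" by fact
    show c_eq: "c i = c j \<longleftrightarrow> i mod m = j mod m" for i j
      using \<phi>c by (metis c_def sum.inject(1))
    show "(c i, c (Suc i)) \<in> parcs G" for i
    proof -
      have "i mod m \<in> K" using C_all KC by simp
      then show ?thesis by (simp add: K_def c_def mod_Suc_eq)
    qed
    show "c j = c (Suc i) \<or> c i = c (Suc j)" if "(c i, c j) \<in> parcs G" for i j
      \<comment> \<open>Pendant vertices lie off \<open>range c\<close>, so only the two successor
        cases of \<open>nb\<close> remain.\<close>
      using nb[OF that] Inr_notin
      by (metis c_eq mod_Suc_eq rangeI)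
    show "\<exists>i. parcs G `` {v} = {c i}" if v: "v \<in> ?V" "v \<notin> range c" for v
    proof -
      obtain i where i: "i \<in> P" "v = \<psi> (Inr i)"
        using V_cases[OF v(1)] v(2) c_lt C_le by (metis lessThan_iff rangeI subsetD)
      have "w = c i" if w: "(v, w) \<in> parcs G" for w
      proof -
        obtain j where "j \<in> P" "w = c j" "v = \<psi> (Inr j)"
          using nb[OF w] v(2) by blast
        moreover have "i = j"
          using i calculation \<phi>\<psi> unfolding P_def by (metis mem_Collect_eq sum.inject(2))
        ultimately show ?thesis by simp
      qed
      moreover have "(v, c i) \<in> parcs G"
      proof -
        have "i \<in> Q" "i < m" using i(1) QP P_le by auto
        then have "(c i, v) \<in> parcs G" by (simp add: Q_def i(2) c_lt)
        then show ?thesis by (rule arcs_symmetric)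
      qed
      ultimately show ?thesis by blast
    qed
    show "v = w" if "(c i, v) \<in> parcs G" "(c i, w) \<in> parcs G" "v \<notin> range c" "w \<notin> range c" for i v w
    proof -
      have pend: "v = \<psi> (Inr (i mod m))" if v: "(c i, v) \<in> parcs G" "v \<notin> range c" for v
      proof -
        obtain j where "j \<in> P" "c i = c j" "v = \<psi> (Inr j)"
          using nb[OF v(1)] v(2) Inr_notin by blast
        then show ?thesis using P_le by (auto simp: c_eq)
      qed
      show ?thesis using pend[OF that(1,3)] pend[OF that(2,4)] by simp
    qed
  qed
  then show ?thesis by blast
qed

lemma broken_sun_eigenfunction:
  assumes "broken_sun G" and "\<nexists>M. perfect_matching G M" and "girth G mod 4 = 0" and "odd_deg2_gaps G"
  obtains f v0 where "\<And>v. v \<in> pverts G \<Longrightarrow> laplacian_op G f v = 2 * f v"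
    "v0 \<in> pverts G" "f v0 \<noteq> 0"
proof -
  obtain m c where "cycle_with_pendants G m c"
    using broken_sun_cycle_with_pendants[OF assms(1)] by blast
  from cycle_with_pendants.eigenfunction[OF this assms(2-4)] show ?thesis
    using that by blast
qed

theorem theorem14:
  fixes G1 G2 G :: "'a pair_pre_digraph" and n1 n2 g1 g2 :: nat and vs :: "'a list"
  assumes "broken_sun G1" and "broken_sun G2"
    and "card (pverts G1) = n1" and "card (pverts G2) = n2"
    and "girth G1 = g1" and "girth G2 = g2"
    and "\<not> (\<exists>M. perfect_matching G1 M)" and "\<not> (\<exists>M. perfect_matching G2 M)"
    and "g1 mod 4 = 0" and "g2 mod 4 = 0"
    and "odd_deg2_gaps G1" and "odd_deg2_gaps G2"
    and "one_edge_connection G1 G2 G"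
    and "distinct vs" and "set vs = pverts G"
  shows "eigenvalue (laplacian_mat G vs) 2"
proof -
  have graphs: "pair_graph G1" "pair_graph G2" "pair_graph G"
    using assms(1,2,13) by (auto simp: broken_sun_def unicyclic_def one_edge_connection_def)
  obtain f1 v1 where f1: "\<And>v. v \<in> pverts G1 \<Longrightarrow> laplacian_op G1 f1 v = 2 * f1 v"
      "v1 \<in> pverts G1" "f1 v1 \<noteq> 0"
    by (rule broken_sun_eigenfunction[of G1]) (use assms in auto)
  obtain f2 v2 where f2: "\<And>v. v \<in> pverts G2 \<Longrightarrow> laplacian_op G2 f2 v = 2 * f2 v"
      "v2 \<in> pverts G2" "f2 v2 \<noteq> 0"
    by (rule broken_sun_eigenfunction[of G2]) (use assms in auto)
  show ?thesis
  proof (rule one_edge_connection_eigenfunction[OF graphs(1,2) assms(13) f1 f2])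
    fix f v0
    assume "\<And>v. v \<in> pverts G \<Longrightarrow> laplacian_op G f v = 2 * f v" "v0 \<in> pverts G" "f v0 \<noteq> 0"
    then show ?thesis
      by (rule pair_graph.eigenvalue_laplacian_mat[OF graphs(3) assms(14,15)])
  qed
qed

end
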